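(* Let $G$ be an abelian group, let $R=\bigoplus_{g\in G}R_g$ be a $G$-graded ring and let $n\geq 1$ be a natural number. Then $R$ is graded NR-clean if and only if the $G$-graded triangular matrix ring $T_n(R)(\sigma)$ is graded NR-clean for every $\sigma\in G^n$.
   Context: All rings are associative with unity (not necessarily commutative). A ring $R$ is $G$-graded if $R=\bigoplus_{g\in G}R_g$ with $R_g$ additive subgroups and $R_gR_h\subseteq R_{gh}$ for all $g,h\in G$. The elements of $h(R)=\bigcup_{g\in G}R_g$ are called homogeneous. A homogeneous element $r$ is graded-regular if $r=rar$ for some $a\in h(R)$; $gr(R)$ is the set of graded-regular elements and $N(R)$ is the set of nilpotent elements of $R$. A $G$-graded ring $R$ is graded NR-clean if every $x\in h(R)$ can be written $x=r+n$ with $r\in gr(R)$ and $n\in N(R)\cap h(R)$. For $\sigma=(h_1,\dots,h_n)\in G^n$, $M_n(R)(\sigma)$ denotes the ring of $n\times n$ matrices over $R$ with the $G$-grading whose $g$-component consists of the matrices $(a_{ij})$ with $a_{ij}\in R_{h_i g h_j^{-1}}$ for all $i,j$. $T_n(R)(\sigma)$ denotes the subring $T_n(R)$ of upper triangular matrices with the induced grading: its $g$-component consists of the upper triangular matrices $(a_{ij})$ with $a_{ij}\in R_{h_i g h_j^{-1}}$ for all $i\le j$. *)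

theory Defs
  imports "HOL-Algebra.Algebra"
begin

text \<open>
  A grading of a ring \<open>R\<close> by a group \<open>G\<close> is a family \<open>A\<close> of additive subgroups indexed by the
  elements of \<open>G\<close>. Values of \<open>A\<close> outside \<open>carrier G\<close> are irrelevant. The internal direct sum
  decomposition says that each element of \<open>R\<close> is, in exactly one way, the sum of a finitely
  supported family of components; the family is taken extensional on \<open>carrier G\<close> so that
  uniqueness can be stated as uniqueness of a function.
\<close>

locale graded_ring = G: group G + R: ring R
  for G :: "('g, 'm) monoid_scheme" and R :: "('a, 'r) ring_scheme" +
  fixes A :: "'g \<Rightarrow> 'a set"
  assumes component_subgroup: "g \<in> carrier G \<Longrightarrow> additive_subgroup (A g) R"
    and component_mult: "\<lbrakk>g \<in> carrier G; h \<in> carrier G; x \<in> A g; y \<in> A h\<rbrakk>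
      \<Longrightarrow> x \<otimes>\<^bsub>R\<^esub> y \<in> A (g \<otimes>\<^bsub>G\<^esub> h)"
    and direct_sum: "x \<in> carrier R \<Longrightarrow>
      \<exists>!f. f \<in> (\<Pi>\<^sub>E g\<in>carrier G. A g) \<and> finite {g \<in> carrier G. f g \<noteq> \<zero>\<^bsub>R\<^esub>} \<and>
           x = (\<Oplus>\<^bsub>R\<^esub>g\<in>{g \<in> carrier G. f g \<noteq> \<zero>\<^bsub>R\<^esub>}. f g)"

definition homogeneous :: "('g, 'm) monoid_scheme \<Rightarrow> ('g \<Rightarrow> 'a set) \<Rightarrow> 'a set" where
  "homogeneous G A = (\<Union>g\<in>carrier G. A g)"

definition graded_regular ::
    "('g, 'm) monoid_scheme \<Rightarrow> ('a, 'r) ring_scheme \<Rightarrow> ('g \<Rightarrow> 'a set) \<Rightarrow> 'a set" where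
  "graded_regular G R A =
    {r \<in> homogeneous G A. \<exists>a\<in>homogeneous G A. r = r \<otimes>\<^bsub>R\<^esub> a \<otimes>\<^bsub>R\<^esub> r}"

definition nilpotents :: "('a, 'r) ring_scheme \<Rightarrow> 'a set" where
  "nilpotents R = {x \<in> carrier R. \<exists>k::nat. k > 0 \<and> x [^]\<^bsub>R\<^esub> k = \<zero>\<^bsub>R\<^esub>}"

locale graded_NR_clean = graded_ring G R A
  for G :: "('g, 'm) monoid_scheme" and R :: "('a, 'r) ring_scheme" and A :: "'g \<Rightarrow> 'a set" +
  assumes NR_clean: "x \<in> homogeneous G A \<Longrightarrow>
    \<exists>r\<in>graded_regular G R A. \<exists>m\<in>nilpotents R \<inter> homogeneous G A. x = r \<oplus>\<^bsub>R\<^esub> m"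

text \<open>
  An \<open>n \<times> n\<close> matrix over \<open>R\<close> is a function on index pairs, extensional on
  \<open>{1..n} \<times> {1..n}\<close>, so that equality of matrices is equality of all entries.
\<close>

definition matrix_ring :: "('a, 'r) ring_scheme \<Rightarrow> nat \<Rightarrow> (nat \<times> nat \<Rightarrow> 'a) ring" where
  "matrix_ring R n =
    \<lparr>carrier = {1..n} \<times> {1..n} \<rightarrow>\<^sub>E carrier R,
     monoid.mult = (\<lambda>M N. \<lambda>(i, j)\<in>{1..n} \<times> {1..n}. \<Oplus>\<^bsub>R\<^esub>k\<in>{1..n}. M (i, k) \<otimes>\<^bsub>R\<^esub> N (k, j)),
     monoid.one = (\<lambda>(i, j)\<in>{1..n} \<times> {1..n}. if i = j then \<one>\<^bsub>R\<^esub> else \<zero>\<^bsub>R\<^esub>),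
     ring.zero = (\<lambda>(i, j)\<in>{1..n} \<times> {1..n}. \<zero>\<^bsub>R\<^esub>),
     ring.add = (\<lambda>M N. \<lambda>(i, j)\<in>{1..n} \<times> {1..n}. M (i, j) \<oplus>\<^bsub>R\<^esub> N (i, j))\<rparr>"

definition triangular_ring :: "('a, 'r) ring_scheme \<Rightarrow> nat \<Rightarrow> (nat \<times> nat \<Rightarrow> 'a) ring" where
  "triangular_ring R n = (matrix_ring R n)
    \<lparr>carrier := {M \<in> carrier (matrix_ring R n). \<forall>i\<in>{1..n}. \<forall>j\<in>{1..n}. j < i \<longrightarrow> M (i, j) = \<zero>\<^bsub>R\<^esub>}\<rparr>"

definition matrix_grading ::
    "('g, 'm) monoid_scheme \<Rightarrow> ('a, 'r) ring_scheme \<Rightarrow> ('g \<Rightarrow> 'a set) \<Rightarrow> nat \<Rightarrow> (nat \<Rightarrow> 'g) \<Rightarrow>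
     'g \<Rightarrow> (nat \<times> nat \<Rightarrow> 'a) set" where
  "matrix_grading G R A n \<sigma> g =
    {M \<in> carrier (matrix_ring R n).
      \<forall>i\<in>{1..n}. \<forall>j\<in>{1..n}. M (i, j) \<in> A (\<sigma> i \<otimes>\<^bsub>G\<^esub> g \<otimes>\<^bsub>G\<^esub> inv\<^bsub>G\<^esub> (\<sigma> j))}"

text \<open>
  For an upper triangular matrix the condition on the entries below the diagonal is vacuous,
  since every component of a grading contains zero.
\<close>

definition triangular_grading ::
    "('g, 'm) monoid_scheme \<Rightarrow> ('a, 'r) ring_scheme \<Rightarrow> ('g \<Rightarrow> 'a set) \<Rightarrow> nat \<Rightarrow> (nat \<Rightarrow> 'g) \<Rightarrow>
     'g \<Rightarrow> (nat \<times> nat \<Rightarrow> 'a) set" where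
  "triangular_grading G R A n \<sigma> g = matrix_grading G R A n \<sigma> g \<inter> carrier (triangular_ring R n)"

end

theory Submission
  imports Defs
begin

text \<open>
  Since \<open>G\<close> is abelian, the diagonal entries of a homogeneous triangular matrix of degree \<open>g\<close> all
  have degree \<open>g\<close>. In a graded NR-clean ring the regular and the nilpotent summand of a homogeneous
  element of degree \<open>g\<close> can be chosen of degree \<open>g\<close>, and an inner inverse of degree \<open>g\<inverse>\<close>. Hence
  the diagonal matrix of the regular parts of the diagonal entries is graded-regular of degree \<open>g\<close>,
  and subtracting it leaves a homogeneous triangular matrix with nilpotent diagonal, which is
  nilpotent. Conversely, for constant \<open>\<sigma>\<close> the projection onto the \<open>(1, 1)\<close> entry is a surjective
  degree-preserving ring homomorphism, so it carries decompositions of matrices to \<open>R\<close>.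
\<close>

section \<open>Finite sums\<close>

text \<open>Induction on the outer index set: splitting off one outer term leaves two sums over
  \<open>J\<close>, which merge by additivity. The exchange is what makes matrix multiplication
  associative.\<close>

lemma (in abelian_monoid) finsum_swap:
  assumes "finite I" "finite J" "\<And>i j. i \<in> I \<Longrightarrow> j \<in> J \<Longrightarrow> f i j \<in> carrier G"
  shows "(\<Oplus>i\<in>I. \<Oplus>j\<in>J. f i j) = (\<Oplus>j\<in>J. \<Oplus>i\<in>I. f i j)"
  using assms(1,3)
proof (induction I rule: finite_induct)
  case empty
  then show ?case by (simp add: finsum_zero)
next
  case (insert a I)
  have a: "f a \<in> J \<rightarrow> carrier G" and I: "\<And>i. i \<in> I \<Longrightarrow> f i \<in> J \<rightarrow> carrier G"
    using insert.prems by auto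
  have "(\<Oplus>i\<in>insert a I. \<Oplus>j\<in>J. f i j) = (\<Oplus>j\<in>J. f a j) \<oplus> (\<Oplus>i\<in>I. \<Oplus>j\<in>J. f i j)"
    using insert.hyps a I by (intro finsum_insert) (auto intro!: finsum_closed)
  also have "\<dots> = (\<Oplus>j\<in>J. f a j) \<oplus> (\<Oplus>j\<in>J. \<Oplus>i\<in>I. f i j)"
    using insert by simp
  also have "\<dots> = (\<Oplus>j\<in>J. f a j \<oplus> (\<Oplus>i\<in>I. f i j))"
    using a I by (intro finsum_addf[symmetric]) (auto intro!: finsum_closed)
  also have "\<dots> = (\<Oplus>j\<in>J. \<Oplus>i\<in>insert a I. f i j)"
    using insert.hyps insert.prems
    by (intro finsum_cong') (auto simp: finsum_insert Pi_def intro!: finsum_closed)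
  finally show ?case .
qed

text \<open>Collapses the sum in a matrix product whenever one factor vanishes for all but one
  summation index, as happens for the identity matrix, for diagonal matrices and for diagonal
  entries of triangular products.\<close>

lemma (in abelian_monoid) finsum_eq_single:
  assumes "finite I" "i \<in> I" "f i \<in> carrier G" "\<And>j. j \<in> I \<Longrightarrow> j \<noteq> i \<Longrightarrow> f j = \<zero>"
  shows "finsum G f I = f i"
proof -
  have "f j \<in> carrier G" if "j \<in> I" for j
    using assms(3) assms(4)[OF that] by (cases "j = i") auto
  then have "finsum G f {i} = finsum G f I"
    using assms by (intro add.finprod_mono_neutral_cong_left) auto
  then show ?thesis
    using assms(3) by simp
qed

text \<open>No finiteness of \<open>I\<close> is required, because a sum over an infinite set is
  zero by convention and zero lies in \<open>H\<close>.\<close>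

lemma (in abelian_group) additive_subgroup_finsum_closed:
  assumes "additive_subgroup H G" "\<And>i. i \<in> I \<Longrightarrow> f i \<in> H"
  shows "finsum G f I \<in> H"
proof -
  interpret H: additive_subgroup H G by fact
  have "f ` I \<subseteq> H" using assms(2) by blast
  then show ?thesis
  proof (induction I rule: infinite_finite_induct)
    case (insert i I)
    then have "f i \<in> H" "f \<in> I \<rightarrow> carrier G" "finsum G f I \<in> H"
      using H.a_subset by auto
    with insert.hyps show ?case
      using H.a_subset by (simp add: finsum_insert subsetD)
  qed auto
qed

section \<open>The triangular matrix ring\<close>

lemma matrix_ring_simps:
  "carrier (matrix_ring R n) = {1..n} \<times> {1..n} \<rightarrow>\<^sub>E carrier R"
  "M \<otimes>\<^bsub>matrix_ring R n\<^esub> N =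
    (\<lambda>(i, j)\<in>{1..n} \<times> {1..n}. \<Oplus>\<^bsub>R\<^esub>k\<in>{1..n}. M (i, k) \<otimes>\<^bsub>R\<^esub> N (k, j))"
  "\<one>\<^bsub>matrix_ring R n\<^esub> = (\<lambda>(i, j)\<in>{1..n} \<times> {1..n}. if i = j then \<one>\<^bsub>R\<^esub> else \<zero>\<^bsub>R\<^esub>)"
  "\<zero>\<^bsub>matrix_ring R n\<^esub> = (\<lambda>(i, j)\<in>{1..n} \<times> {1..n}. \<zero>\<^bsub>R\<^esub>)"
  "M \<oplus>\<^bsub>matrix_ring R n\<^esub> N = (\<lambda>(i, j)\<in>{1..n} \<times> {1..n}. M (i, j) \<oplus>\<^bsub>R\<^esub> N (i, j))"
  by (simp_all add: matrix_ring_def)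

lemma triangular_ring_simps:
  "carrier (triangular_ring R n) = {M \<in> {1..n} \<times> {1..n} \<rightarrow>\<^sub>E carrier R.
     \<forall>i\<in>{1..n}. \<forall>j\<in>{1..n}. j < i \<longrightarrow> M (i, j) = \<zero>\<^bsub>R\<^esub>}"
  "M \<otimes>\<^bsub>triangular_ring R n\<^esub> N = M \<otimes>\<^bsub>matrix_ring R n\<^esub> N"
  "\<one>\<^bsub>triangular_ring R n\<^esub> = \<one>\<^bsub>matrix_ring R n\<^esub>"
  "\<zero>\<^bsub>triangular_ring R n\<^esub> = \<zero>\<^bsub>matrix_ring R n\<^esub>"
  "M \<oplus>\<^bsub>triangular_ring R n\<^esub> N = M \<oplus>\<^bsub>matrix_ring R n\<^esub> N"
  by (simp_all add: triangular_ring_def matrix_ring_def)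

lemma matrix_eqI:
  assumes "M \<in> carrier (matrix_ring R n)" "N \<in> carrier (matrix_ring R n)"
    and "\<And>i j. i \<in> {1..n} \<Longrightarrow> j \<in> {1..n} \<Longrightarrow> M (i, j) = N (i, j)"
  shows "M = N"
  using assms unfolding matrix_ring_simps by (intro PiE_ext) auto

text \<open>Below the diagonal both matrices are zero, so only the entries on and above it have to
  be compared.\<close>

lemma triangular_eqI:
  assumes "M \<in> carrier (triangular_ring R n)" "N \<in> carrier (triangular_ring R n)"
    and "\<And>i j. i \<in> {1..n} \<Longrightarrow> j \<in> {1..n} \<Longrightarrow> i \<le> j \<Longrightarrow> M (i, j) = N (i, j)"
  shows "M = N"
proof (rule matrix_eqI)
  show "M \<in> carrier (matrix_ring R n)" "N \<in> carrier (matrix_ring R n)"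
    using assms by (auto simp: triangular_ring_simps matrix_ring_simps)
  show "M (i, j) = N (i, j)" if "i \<in> {1..n}" "j \<in> {1..n}" for i j
    using assms that by (cases "i \<le> j") (auto simp: triangular_ring_simps)
qed

lemma matrix_entry_closed [intro]:
  assumes "M \<in> carrier (matrix_ring R n)" "i \<in> {1..n}" "j \<in> {1..n}"
  shows "M (i, j) \<in> carrier R"
  using assms by (auto simp: matrix_ring_simps dest: PiE_mem)

lemma triangular_entry_closed [intro]:
  assumes "M \<in> carrier (triangular_ring R n)" "i \<in> {1..n}" "j \<in> {1..n}"
  shows "M (i, j) \<in> carrier R"
  using assms by (auto simp: triangular_ring_simps dest: PiE_mem)

lemma triangular_entry_zero:
  assumes "M \<in> carrier (triangular_ring R n)" "i \<in> {1..n}" "j \<in> {1..n}" "j < i"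
  shows "M (i, j) = \<zero>\<^bsub>R\<^esub>"
  using assms by (auto simp: triangular_ring_simps)

lemma matrix_mult_entry:
  assumes "i \<in> {1..n}" "j \<in> {1..n}"
  shows "(M \<otimes>\<^bsub>matrix_ring R n\<^esub> N) (i, j) = (\<Oplus>\<^bsub>R\<^esub>k\<in>{1..n}. M (i, k) \<otimes>\<^bsub>R\<^esub> N (k, j))"
  using assms by (simp add: matrix_ring_simps)

lemma matrix_add_entry:
  assumes "i \<in> {1..n}" "j \<in> {1..n}"
  shows "(M \<oplus>\<^bsub>matrix_ring R n\<^esub> N) (i, j) = M (i, j) \<oplus>\<^bsub>R\<^esub> N (i, j)"
  using assms by (simp add: matrix_ring_simps)

lemma matrix_zero_entry:
  "i \<in> {1..n} \<Longrightarrow> j \<in> {1..n} \<Longrightarrow> \<zero>\<^bsub>matrix_ring R n\<^esub> (i, j) = \<zero>\<^bsub>R\<^esub>"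
  by (simp add: matrix_ring_simps)

lemma matrix_one_entry:
  "i \<in> {1..n} \<Longrightarrow> j \<in> {1..n} \<Longrightarrow>
    \<one>\<^bsub>matrix_ring R n\<^esub> (i, j) = (if i = j then \<one>\<^bsub>R\<^esub> else \<zero>\<^bsub>R\<^esub>)"
  by (simp add: matrix_ring_simps)

lemmas matrix_entries = matrix_mult_entry matrix_add_entry matrix_zero_entry matrix_one_entry

section \<open>Ring structure on all matrices and on the triangular ones\<close>

context ring
begin

lemma matrix_add_closed:
  "M \<in> carrier (matrix_ring R n) \<Longrightarrow> N \<in> carrier (matrix_ring R n) \<Longrightarrow>
    M \<oplus>\<^bsub>matrix_ring R n\<^esub> N \<in> carrier (matrix_ring R n)"
  by (auto simp: matrix_ring_simps dest: PiE_mem)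

lemma matrix_zero_closed: "\<zero>\<^bsub>matrix_ring R n\<^esub> \<in> carrier (matrix_ring R n)"
  by (auto simp: matrix_ring_simps)

lemma matrix_one_closed: "\<one>\<^bsub>matrix_ring R n\<^esub> \<in> carrier (matrix_ring R n)"
  by (auto simp: matrix_ring_simps)

lemma matrix_mult_closed:
  "M \<in> carrier (matrix_ring R n) \<Longrightarrow> N \<in> carrier (matrix_ring R n) \<Longrightarrow>
    M \<otimes>\<^bsub>matrix_ring R n\<^esub> N \<in> carrier (matrix_ring R n)"
  by (subst matrix_ring_simps(1), subst matrix_ring_simps(2))
     (auto simp: matrix_entry_closed intro!: finsum_closed)

text \<open>Entrywise, both sides expand by distributivity to the same double sum of triple
  products; between the two expansions the order of summation is exchanged.\<close>

lemma matrix_mult_assoc: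
  assumes L: "L \<in> carrier (matrix_ring R n)" and M: "M \<in> carrier (matrix_ring R n)"
    and N: "N \<in> carrier (matrix_ring R n)"
  shows "(L \<otimes>\<^bsub>matrix_ring R n\<^esub> M) \<otimes>\<^bsub>matrix_ring R n\<^esub> N =
    L \<otimes>\<^bsub>matrix_ring R n\<^esub> (M \<otimes>\<^bsub>matrix_ring R n\<^esub> N)"
proof (rule matrix_eqI)
  note entry = L[THEN matrix_entry_closed] M[THEN matrix_entry_closed] N[THEN matrix_entry_closed]
  fix i j assume ij: "i \<in> {1..n}" "j \<in> {1..n}"
  have "((L \<otimes>\<^bsub>matrix_ring R n\<^esub> M) \<otimes>\<^bsub>matrix_ring R n\<^esub> N) (i, j) =
      (\<Oplus>k\<in>{1..n}. (\<Oplus>l\<in>{1..n}. L (i, l) \<otimes> M (l, k)) \<otimes> N (k, j))"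
    unfolding matrix_mult_entry[OF ij] using ij entry
    by (intro finsum_cong') (auto simp: matrix_mult_entry intro!: finsum_closed)
  also have "\<dots> = (\<Oplus>k\<in>{1..n}. \<Oplus>l\<in>{1..n}. L (i, l) \<otimes> M (l, k) \<otimes> N (k, j))"
    using ij entry by (intro finsum_cong') (auto intro!: finsum_ldistr finsum_closed)
  also have "\<dots> = (\<Oplus>l\<in>{1..n}. \<Oplus>k\<in>{1..n}. L (i, l) \<otimes> M (l, k) \<otimes> N (k, j))"
    using ij entry by (intro finsum_swap) auto
  also have "\<dots> = (\<Oplus>l\<in>{1..n}. \<Oplus>k\<in>{1..n}. L (i, l) \<otimes> (M (l, k) \<otimes> N (k, j)))"
    using ij entry by (intro finsum_cong') (auto simp: m_assoc intro!: finsum_closed finsum_cong')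
  also have "\<dots> = (\<Oplus>l\<in>{1..n}. L (i, l) \<otimes> (\<Oplus>k\<in>{1..n}. M (l, k) \<otimes> N (k, j)))"
    using ij entry by (intro finsum_cong') (auto intro!: finsum_rdistr[symmetric] finsum_closed)
  also have "\<dots> = (L \<otimes>\<^bsub>matrix_ring R n\<^esub> (M \<otimes>\<^bsub>matrix_ring R n\<^esub> N)) (i, j)"
    unfolding matrix_mult_entry[OF ij] using ij entry
    by (intro finsum_cong') (auto simp: matrix_mult_entry intro!: finsum_closed)
  finally show "((L \<otimes>\<^bsub>matrix_ring R n\<^esub> M) \<otimes>\<^bsub>matrix_ring R n\<^esub> N) (i, j) =
    (L \<otimes>\<^bsub>matrix_ring R n\<^esub> (M \<otimes>\<^bsub>matrix_ring R n\<^esub> N)) (i, j)" .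
qed (use assms in \<open>auto intro!: matrix_mult_closed\<close>)

lemma ring_matrix_ring: "ring (matrix_ring R n)"
proof (rule ringI)
  note closed = matrix_add_closed matrix_zero_closed matrix_one_closed matrix_mult_closed
  show "abelian_group (matrix_ring R n)"
  proof (rule abelian_groupI)
    fix M assume M: "M \<in> carrier (matrix_ring R n)"
    show "\<exists>N\<in>carrier (matrix_ring R n). N \<oplus>\<^bsub>matrix_ring R n\<^esub> M = \<zero>\<^bsub>matrix_ring R n\<^esub>"
    proof (rule bexI)
      show neg: "(\<lambda>(i, j)\<in>{1..n} \<times> {1..n}. \<ominus> M (i, j)) \<in> carrier (matrix_ring R n)"
        using M by (auto simp: matrix_ring_simps dest: PiE_mem)
      show "(\<lambda>(i, j)\<in>{1..n} \<times> {1..n}. \<ominus> M (i, j)) \<oplus>\<^bsub>matrix_ring R n\<^esub> M = \<zero>\<^bsub>matrix_ring R n\<^esub>"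
        using M neg
        by (intro matrix_eqI[of _ R n])
           (auto simp: matrix_entries l_neg matrix_entry_closed intro!: closed)
    qed
  qed (auto intro!: closed matrix_eqI[of _ R n]
        simp: matrix_entries a_ac matrix_entry_closed)
  show "monoid (matrix_ring R n)"
  proof (rule monoidI)
    fix M assume M: "M \<in> carrier (matrix_ring R n)"
    show "\<one>\<^bsub>matrix_ring R n\<^esub> \<otimes>\<^bsub>matrix_ring R n\<^esub> M = M"
    proof (rule matrix_eqI)
      fix i j assume ij: "i \<in> {1..n}" "j \<in> {1..n}"
      have "(\<one>\<^bsub>matrix_ring R n\<^esub> \<otimes>\<^bsub>matrix_ring R n\<^esub> M) (i, j) =
          \<one>\<^bsub>matrix_ring R n\<^esub> (i, i) \<otimes> M (i, j)"
        unfolding matrix_mult_entry[OF ij] using M ij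
        by (intro finsum_eq_single) (auto simp: matrix_one_entry matrix_entry_closed)
      then show "(\<one>\<^bsub>matrix_ring R n\<^esub> \<otimes>\<^bsub>matrix_ring R n\<^esub> M) (i, j) = M (i, j)"
        using M ij by (simp add: matrix_one_entry matrix_entry_closed)
    qed (use M in \<open>auto intro!: closed\<close>)
    show "M \<otimes>\<^bsub>matrix_ring R n\<^esub> \<one>\<^bsub>matrix_ring R n\<^esub> = M"
    proof (rule matrix_eqI)
      fix i j assume ij: "i \<in> {1..n}" "j \<in> {1..n}"
      have "(M \<otimes>\<^bsub>matrix_ring R n\<^esub> \<one>\<^bsub>matrix_ring R n\<^esub>) (i, j) =
          M (i, j) \<otimes> \<one>\<^bsub>matrix_ring R n\<^esub> (j, j)"
        unfolding matrix_mult_entry[OF ij] using M ij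
        by (intro finsum_eq_single) (auto simp: matrix_one_entry matrix_entry_closed)
      then show "(M \<otimes>\<^bsub>matrix_ring R n\<^esub> \<one>\<^bsub>matrix_ring R n\<^esub>) (i, j) = M (i, j)"
        using M ij by (simp add: matrix_one_entry matrix_entry_closed)
    qed (use M in \<open>auto intro!: closed\<close>)
  qed (auto intro!: closed matrix_mult_assoc)
  fix L M N
  assume L: "L \<in> carrier (matrix_ring R n)" and M: "M \<in> carrier (matrix_ring R n)"
    and N: "N \<in> carrier (matrix_ring R n)"
  note entry = L[THEN matrix_entry_closed] M[THEN matrix_entry_closed] N[THEN matrix_entry_closed]
  show "(L \<oplus>\<^bsub>matrix_ring R n\<^esub> M) \<otimes>\<^bsub>matrix_ring R n\<^esub> N =
      L \<otimes>\<^bsub>matrix_ring R n\<^esub> N \<oplus>\<^bsub>matrix_ring R n\<^esub> M \<otimes>\<^bsub>matrix_ring R n\<^esub> N"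
  proof (rule matrix_eqI)
    fix i j assume ij: "i \<in> {1..n}" "j \<in> {1..n}"
    have "(\<Oplus>k\<in>{1..n}. (L \<oplus>\<^bsub>matrix_ring R n\<^esub> M) (i, k) \<otimes> N (k, j)) =
        (\<Oplus>k\<in>{1..n}. L (i, k) \<otimes> N (k, j) \<oplus> M (i, k) \<otimes> N (k, j))"
      using ij entry by (intro finsum_cong') (auto simp: matrix_add_entry l_distr)
    also have "\<dots> = (\<Oplus>k\<in>{1..n}. L (i, k) \<otimes> N (k, j)) \<oplus> (\<Oplus>k\<in>{1..n}. M (i, k) \<otimes> N (k, j))"
      using ij entry by (intro finsum_addf) auto
    finally show "((L \<oplus>\<^bsub>matrix_ring R n\<^esub> M) \<otimes>\<^bsub>matrix_ring R n\<^esub> N) (i, j) =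
        (L \<otimes>\<^bsub>matrix_ring R n\<^esub> N \<oplus>\<^bsub>matrix_ring R n\<^esub> M \<otimes>\<^bsub>matrix_ring R n\<^esub> N) (i, j)"
      by (simp only: matrix_mult_entry[OF ij] matrix_add_entry[OF ij])
  qed (use L M N in \<open>auto intro!: closed\<close>)
  show "N \<otimes>\<^bsub>matrix_ring R n\<^esub> (L \<oplus>\<^bsub>matrix_ring R n\<^esub> M) =
      N \<otimes>\<^bsub>matrix_ring R n\<^esub> L \<oplus>\<^bsub>matrix_ring R n\<^esub> N \<otimes>\<^bsub>matrix_ring R n\<^esub> M"
  proof (rule matrix_eqI)
    fix i j assume ij: "i \<in> {1..n}" "j \<in> {1..n}"
    have "(\<Oplus>k\<in>{1..n}. N (i, k) \<otimes> (L \<oplus>\<^bsub>matrix_ring R n\<^esub> M) (k, j)) =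
        (\<Oplus>k\<in>{1..n}. N (i, k) \<otimes> L (k, j) \<oplus> N (i, k) \<otimes> M (k, j))"
      using ij entry by (intro finsum_cong') (auto simp: matrix_add_entry r_distr)
    also have "\<dots> = (\<Oplus>k\<in>{1..n}. N (i, k) \<otimes> L (k, j)) \<oplus> (\<Oplus>k\<in>{1..n}. N (i, k) \<otimes> M (k, j))"
      using ij entry by (intro finsum_addf) auto
    finally show "(N \<otimes>\<^bsub>matrix_ring R n\<^esub> (L \<oplus>\<^bsub>matrix_ring R n\<^esub> M)) (i, j) =
        (N \<otimes>\<^bsub>matrix_ring R n\<^esub> L \<oplus>\<^bsub>matrix_ring R n\<^esub> N \<otimes>\<^bsub>matrix_ring R n\<^esub> M) (i, j)"
      by (simp only: matrix_mult_entry[OF ij] matrix_add_entry[OF ij])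
  qed (use L M N in \<open>auto intro!: closed\<close>)
qed

text \<open>The negative is defined abstractly as an inverse, so its entries are found from the
  uniqueness of additive inverses in \<open>R\<close>.\<close>

lemma matrix_neg_entry:
  assumes "M \<in> carrier (matrix_ring R n)" "i \<in> {1..n}" "j \<in> {1..n}"
  shows "(\<ominus>\<^bsub>matrix_ring R n\<^esub> M) (i, j) = \<ominus> M (i, j)"
proof -
  interpret M: ring "matrix_ring R n" by (rule ring_matrix_ring)
  have "(\<ominus>\<^bsub>matrix_ring R n\<^esub> M \<oplus>\<^bsub>matrix_ring R n\<^esub> M) (i, j) = \<zero>"
    using assms by (simp add: M.l_neg matrix_zero_entry)
  then show ?thesis
    using assms M.a_inv_closed[OF assms(1)]
    by (intro minus_equality[symmetric]) (auto simp: matrix_add_entry matrix_entry_closed)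
qed

text \<open>The triangular matrices form a subring of the full matrix ring, so the ring axioms are
  inherited and only closure is at stake.\<close>

lemma ring_triangular_ring: "ring (triangular_ring R n)"
proof -
  interpret M: ring "matrix_ring R n" by (rule ring_matrix_ring)
  \<comment> \<open>As \<open>j < i\<close>, every \<open>k\<close> satisfies \<open>k < i\<close>
    or \<open>j < k\<close>. In the first case the left factor lies below the diagonal, in the
    second the right one does.\<close>
  have zero: "M (i, k) \<otimes> N (k, j) = \<zero>"
    if "M \<in> carrier (triangular_ring R n)" "N \<in> carrier (triangular_ring R n)"
      "i \<in> {1..n}" "j \<in> {1..n}" "k \<in> {1..n}" "j < i" for M N i j k
    using that by (cases "k < i") (auto simp: triangular_entry_zero triangular_entry_closed)
  have sub: "carrier (triangular_ring R n) \<subseteq> carrier (matrix_ring R n)"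
    by (auto simp: triangular_ring_def)
  have iff: "M \<in> carrier (triangular_ring R n) \<longleftrightarrow> M \<in> carrier (matrix_ring R n) \<and>
      (\<forall>i\<in>{1..n}. \<forall>j\<in>{1..n}. j < i \<longrightarrow> M (i, j) = \<zero>)" for M
    by (simp add: triangular_ring_def)
  have "subring (carrier (triangular_ring R n)) (matrix_ring R n)"
  proof (rule M.subringI)
    fix M N
    assume MN: "M \<in> carrier (triangular_ring R n)" "N \<in> carrier (triangular_ring R n)"
    then show "M \<otimes>\<^bsub>matrix_ring R n\<^esub> N \<in> carrier (triangular_ring R n)"
      unfolding iff[of "M \<otimes>\<^bsub>matrix_ring R n\<^esub> N"] using zero[OF MN] sub
      by (auto simp: matrix_mult_entry cong: finsum_cong intro!: M.m_closed add.finprod_one_eqI)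
    show "M \<oplus>\<^bsub>matrix_ring R n\<^esub> N \<in> carrier (triangular_ring R n)"
      using MN unfolding iff by (auto simp: matrix_add_entry)
  qed (auto simp: iff matrix_one_entry matrix_neg_entry)
  then have "ring (matrix_ring R n \<lparr>carrier := carrier (triangular_ring R n)\<rparr>)"
    by (rule M.subring_is_ring)
  then show ?thesis
    by (simp add: triangular_ring_def)
qed

section \<open>Diagonals, powers and nilpotency of triangular matrices\<close>

lemma triangular_mult_diagonal:
  assumes M: "M \<in> carrier (triangular_ring R n)" and N: "N \<in> carrier (triangular_ring R n)"
    and i: "i \<in> {1..n}"
  shows "(M \<otimes>\<^bsub>triangular_ring R n\<^esub> N) (i, i) = M (i, i) \<otimes> N (i, i)"
  unfolding triangular_ring_simps matrix_mult_entry[OF i i]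
proof (rule finsum_eq_single)
  fix k assume "k \<in> {1..n}" "k \<noteq> i"
  then show "M (i, k) \<otimes> N (k, i) = \<zero>"
    using assms
    \<comment> \<open>For \<open>k < i\<close> the factor \<open>M (i, k)\<close> vanishes, for
      \<open>k > i\<close> the factor \<open>N (k, i)\<close> does.\<close>
    by (cases "k < i") (auto simp: triangular_entry_zero triangular_entry_closed)
qed (use assms in \<open>auto simp: triangular_entry_closed\<close>)

lemma triangular_pow_diagonal:
  assumes M: "M \<in> carrier (triangular_ring R n)" and i: "i \<in> {1..n}"
  shows "(M [^]\<^bsub>triangular_ring R n\<^esub> (k::nat)) (i, i) = M (i, i) [^] k"
proof -
  interpret T: ring "triangular_ring R n" by (rule ring_triangular_ring)
  show ?thesis
    using assms
    by (induction k) (simp_all add: triangular_mult_diagonal triangular_ring_simps(3) matrix_one_entry)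
qed

text \<open>Each further factor with zero diagonal pushes the possibly nonzero entries up by one
  more diagonal.\<close>

lemma strictly_triangular_pow_entry:
  assumes M: "M \<in> carrier (triangular_ring R n)"
    and diag: "\<And>i. i \<in> {1..n} \<Longrightarrow> M (i, i) = \<zero>"
    and ij: "i \<in> {1..n}" "j \<in> {1..n}" "j < i + k"
  shows "(M [^]\<^bsub>triangular_ring R n\<^esub> (k::nat)) (i, j) = \<zero>"
proof -
  interpret T: ring "triangular_ring R n" by (rule ring_triangular_ring)
  show ?thesis
    using ij
  proof (induction k arbitrary: j)
    case 0
    then show ?case by (simp add: triangular_ring_simps(3) matrix_one_entry)
  next
    case (Suc k)
    let ?N = "M [^]\<^bsub>triangular_ring R n\<^esub> k"
    have N: "?N \<in> carrier (triangular_ring R n)"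
      using M by simp
    \<comment> \<open>For \<open>l < i + k\<close> the left factor is zero by induction. Otherwise
      \<open>j < i + Suc k\<close> forces \<open>j \<le> l\<close>, and \<open>M (l, j)\<close> is a
      diagonal entry or lies below the diagonal.\<close>
    have "?N (i, l) \<otimes> M (l, j) = \<zero>" if l: "l \<in> {1..n}" for l
    proof (cases "l < i + k")
      case True
      then show ?thesis
        using Suc.IH[of l] Suc.prems M l by (simp add: triangular_entry_closed)
    next
      case False
      then have "M (l, j) = \<zero>"
        using Suc.prems l diag triangular_entry_zero[OF M] by (cases "l = j") auto
      then show ?thesis
        using N l Suc.prems triangular_entry_closed[OF N, of i l] by simp
    qed
    then have "(\<Oplus>l\<in>{1..n}. ?N (i, l) \<otimes> M (l, j)) = \<zero>"
      by (rule add.finprod_one_eqI)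
    then show ?case
      unfolding T.nat_pow_Suc
      by (simp only: triangular_ring_simps matrix_mult_entry[OF Suc.prems(1,2)])
  qed
qed

text \<open>Two stages: a common exponent \<open>m\<close> kills the diagonal of the power, since
  diagonals multiply entrywise; the \<open>n\<close>-th power of the resulting strictly triangular
  matrix is then zero.\<close>

lemma triangular_nilpotentI:
  assumes M: "M \<in> carrier (triangular_ring R n)"
    and diag: "\<And>i. i \<in> {1..n} \<Longrightarrow> M (i, i) \<in> nilpotents R"
  shows "M \<in> nilpotents (triangular_ring R n)"
proof -
  interpret T: ring "triangular_ring R n" by (rule ring_triangular_ring)
  obtain e where e: "\<And>i. i \<in> {1..n} \<Longrightarrow> M (i, i) [^] (e i :: nat) = \<zero>"
    using diag unfolding nilpotents_def by simp metis
  \<comment> \<open>The sum serves only as a common upper bound of the exponents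
    \<open>e i\<close>.\<close>
  define m where "m = sum e {1..n}"
  let ?N = "M [^]\<^bsub>triangular_ring R n\<^esub> m"
  have N: "?N \<in> carrier (triangular_ring R n)"
    using M by simp
  have "?N (i, i) = \<zero>" if i: "i \<in> {1..n}" for i
  proof -
    have "e i \<le> m"
      unfolding m_def using i by (intro member_le_sum) auto
    then have "M (i, i) [^] m = M (i, i) [^] e i \<otimes> M (i, i) [^] (m - e i)"
      using M i by (simp add: nat_pow_mult triangular_entry_closed)
    then show ?thesis
      using M i by (simp add: triangular_pow_diagonal e triangular_entry_closed)
  qed
  \<comment> \<open>Indices start at 1, so \<open>j \<le> n < i + n\<close> holds for every position
    and all entries of the \<open>n\<close>-th power vanish.\<close>
  then have "?N [^]\<^bsub>triangular_ring R n\<^esub> n = \<zero>\<^bsub>triangular_ring R n\<^esub>"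
    using strictly_triangular_pow_entry[OF N] T.nat_pow_closed[OF N] T.zero_closed
    by (intro triangular_eqI[of _ R n]) (simp_all add: triangular_ring_simps(4) matrix_zero_entry)
  then have "M [^]\<^bsub>triangular_ring R n\<^esub> (m * n) = \<zero>\<^bsub>triangular_ring R n\<^esub>"
    using M by (simp add: T.nat_pow_pow)
  \<comment> \<open>The definition of \<open>nilpotents\<close> asks for a positive exponent, and
    \<open>m * n\<close> is 0 when \<open>n = 0\<close>.\<close>
  then have "M [^]\<^bsub>triangular_ring R n\<^esub> Suc (m * n) = \<zero>\<^bsub>triangular_ring R n\<^esub>"
    using M by simp
  then show ?thesis
    unfolding nilpotents_def using M by blast
qed

text \<open>The abstract inverse depends on the carrier, so the negative is determined afresh here
  instead of being read off from the full matrix ring.\<close>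

lemma triangular_neg_entry:
  assumes "M \<in> carrier (triangular_ring R n)" "i \<in> {1..n}" "j \<in> {1..n}"
  shows "(\<ominus>\<^bsub>triangular_ring R n\<^esub> M) (i, j) = \<ominus> M (i, j)"
proof -
  interpret T: ring "triangular_ring R n" by (rule ring_triangular_ring)
  have "(\<ominus>\<^bsub>triangular_ring R n\<^esub> M \<oplus>\<^bsub>triangular_ring R n\<^esub> M) (i, j) = \<zero>"
    using assms by (simp add: T.l_neg triangular_ring_simps(4) matrix_zero_entry)
  then show ?thesis
    using assms T.a_inv_closed[OF assms(1)]
    by (intro minus_equality[symmetric])
       (auto simp: triangular_ring_simps(5) matrix_add_entry triangular_entry_closed)
qed

text \<open>Evaluation at a position is additive; for infinite \<open>F\<close> both sides are zero
  by convention.\<close>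

lemma triangular_finsum_entry:
  assumes "f \<in> F \<rightarrow> carrier (triangular_ring R n)" "i \<in> {1..n}" "j \<in> {1..n}"
  shows "(finsum (triangular_ring R n) f F) (i, j) = (\<Oplus>g\<in>F. f g (i, j))"
proof -
  interpret T: ring "triangular_ring R n" by (rule ring_triangular_ring)
  show ?thesis
    using assms
  proof (induction F rule: infinite_finite_induct)
    case (insert g F)
    then have "(\<Oplus>h\<in>insert g F. f h (i, j)) = f g (i, j) \<oplus> (\<Oplus>h\<in>F. f h (i, j))"
      by (intro finsum_insert) (auto simp: Pi_iff triangular_entry_closed)
    with insert show ?case
      by (simp add: T.finsum_insert triangular_ring_simps(5) matrix_add_entry)
  qed (auto simp: T.finsum_infinite finsum_infinite triangular_ring_simps(4) matrix_zero_entry)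
qed

end

section \<open>Graded rings\<close>

context graded_ring
begin

section \<open>Components and homogeneous decompositions\<close>

lemma component_closed: "g \<in> carrier G \<Longrightarrow> x \<in> A g \<Longrightarrow> x \<in> carrier R"
  using component_subgroup additive_subgroup.a_subset by blast

lemma component_zero: "g \<in> carrier G \<Longrightarrow> \<zero>\<^bsub>R\<^esub> \<in> A g"
  using component_subgroup additive_subgroup.zero_closed by blast

lemma component_add: "g \<in> carrier G \<Longrightarrow> x \<in> A g \<Longrightarrow> y \<in> A g \<Longrightarrow> x \<oplus>\<^bsub>R\<^esub> y \<in> A g"
  using additive_subgroup.a_closed[OF component_subgroup] .

lemma component_neg: "g \<in> carrier G \<Longrightarrow> x \<in> A g \<Longrightarrow> \<ominus>\<^bsub>R\<^esub> x \<in> A g"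
  unfolding a_inv_def
  by (rule subgroup.m_inv_closed[OF additive_subgroup.a_subgroup[OF component_subgroup]])

text \<open>The sum may run over any finite \<open>F\<close> containing the support, because the
  added terms are zero. This lets several elements be decomposed over one common index set.\<close>

lemma obtain_decomposition:
  assumes "x \<in> carrier R"
  obtains f where "\<And>g. g \<in> carrier G \<Longrightarrow> f g \<in> A g"
    and "finite {g \<in> carrier G. f g \<noteq> \<zero>\<^bsub>R\<^esub>}"
    and "\<And>F. finite F \<Longrightarrow> F \<subseteq> carrier G \<Longrightarrow> {g \<in> carrier G. f g \<noteq> \<zero>\<^bsub>R\<^esub>} \<subseteq> F \<Longrightarrow> finsum R f F = x"
proof -
  obtain f where f: "f \<in> (\<Pi>\<^sub>E g\<in>carrier G. A g)" "finite {g \<in> carrier G. f g \<noteq> \<zero>\<^bsub>R\<^esub>}"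
    "x = (\<Oplus>\<^bsub>R\<^esub>g\<in>{g \<in> carrier G. f g \<noteq> \<zero>\<^bsub>R\<^esub>}. f g)"
    using direct_sum[OF assms] by blast
  have mem: "f g \<in> A g" if "g \<in> carrier G" for g
    using f(1) that by (rule PiE_mem)
  have "finsum R f F = x"
    if "finite F" "F \<subseteq> carrier G" "{g \<in> carrier G. f g \<noteq> \<zero>\<^bsub>R\<^esub>} \<subseteq> F" for F
    using that mem component_closed unfolding f(3)
    by (intro R.add.finprod_mono_neutral_cong_right) auto
  then show thesis
    using that mem f(2) by blast
qed

text \<open>A working form of the uniqueness in \<open>direct_sum\<close>: the families live on a
  finite set and may take the value zero there.\<close>

lemma decomposition_unique:
  assumes F: "finite F" "F \<subseteq> carrier G"
    and f: "\<And>g. g \<in> F \<Longrightarrow> f g \<in> A g" and h: "\<And>g. g \<in> F \<Longrightarrow> h g \<in> A g"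
    and eq: "finsum R f F = finsum R h F" and g: "g \<in> F"
  shows "f g = h g"
proof -
  \<comment> \<open>Extension by zero to an extensional family on \<open>carrier G\<close>, the
    shape to which \<open>direct_sum\<close> applies.\<close>
  define E where "E u = (\<lambda>g\<in>carrier G. if g \<in> F then u g else \<zero>\<^bsub>R\<^esub>)"
    for u :: "'g \<Rightarrow> 'a"
  have E: "E u \<in> (\<Pi>\<^sub>E g\<in>carrier G. A g) \<and> finite {g \<in> carrier G. E u g \<noteq> \<zero>\<^bsub>R\<^esub>} \<and>
      finsum R u F = (\<Oplus>\<^bsub>R\<^esub>g\<in>{g \<in> carrier G. E u g \<noteq> \<zero>\<^bsub>R\<^esub>}. E u g)"
    if u: "\<And>g. g \<in> F \<Longrightarrow> u g \<in> A g" for u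
  proof (intro conjI)
    show "E u \<in> (\<Pi>\<^sub>E g\<in>carrier G. A g)"
      using u component_zero by (auto simp: E_def)
    have sub: "{g \<in> carrier G. E u g \<noteq> \<zero>\<^bsub>R\<^esub>} \<subseteq> F"
      by (auto simp: E_def)
    then show "finite {g \<in> carrier G. E u g \<noteq> \<zero>\<^bsub>R\<^esub>}"
      using F(1) finite_subset by blast
    show "finsum R u F = (\<Oplus>\<^bsub>R\<^esub>g\<in>{g \<in> carrier G. E u g \<noteq> \<zero>\<^bsub>R\<^esub>}. E u g)"
      using F sub u component_closed
      by (intro R.add.finprod_mono_neutral_cong_right) (auto simp: E_def)
  qed
  have "finsum R f F \<in> carrier R"
    using f F component_closed by (intro R.finsum_closed) blast
  note unique = the1_equality[OF direct_sum[OF this]]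
  have "E f = E h"
    using unique[OF E[of f]] unique[OF E[of h, folded eq]] f h by auto
  then have "E f g = E h g"
    by simp
  then show ?thesis
    using F g by (auto simp: E_def subset_iff)
qed

text \<open>Meant for \<open>p\<close> sending the degree of a matrix to the degree of its entry at
  a fixed position. The families are carried along the inverse \<open>q\<close> of \<open>p\<close>
  to the image of \<open>F\<close>, where uniqueness by degree applies.\<close>

lemma decomposition_unique_reindex:
  assumes F: "finite F" "inj_on p F" "p ` F \<subseteq> carrier G"
    and f: "\<And>g. g \<in> F \<Longrightarrow> f g \<in> A (p g)" and h: "\<And>g. g \<in> F \<Longrightarrow> h g \<in> A (p g)"
    and eq: "finsum R f F = finsum R h F" and g: "g \<in> F"
  shows "f g = h g"
proof -
  define q where "q = inv_into F p"
  have q: "q (p g) = g" if "g \<in> F" for g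
    using F(2) that by (simp add: q_def)
  have sum: "finsum R (u \<circ> q) (p ` F) = finsum R u F" if "\<And>g. g \<in> F \<Longrightarrow> u g \<in> A (p g)" for u
  proof -
    have u: "u g \<in> carrier R" if "g \<in> F" for g
      using F(3) \<open>\<And>g. g \<in> F \<Longrightarrow> u g \<in> A (p g)\<close>[OF that] that component_closed by blast
    have "finsum R (u \<circ> q) (p ` F) = (\<Oplus>\<^bsub>R\<^esub>g\<in>F. (u \<circ> q) (p g))"
      using u q F(2) by (intro R.finsum_reindex) auto
    also have "\<dots> = finsum R u F"
      using u q by (intro R.finsum_cong') auto
    finally show ?thesis .
  qed
  have "(f \<circ> q) (p g) = (h \<circ> q) (p g)"
  proof (rule decomposition_unique[of "p ` F"])
    show "finsum R (f \<circ> q) (p ` F) = finsum R (h \<circ> q) (p ` F)"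
      using sum[OF f] sum[OF h] eq by simp
  qed (use F f h g q in auto)
  then show ?thesis
    using g q by simp
qed

section \<open>Degrees of inner inverses and of regular and nilpotent summands\<close>

lemma component_inter:
  assumes "g \<in> carrier G" "h \<in> carrier G" "g \<noteq> h" "x \<in> A g" "x \<in> A h"
  shows "x = \<zero>\<^bsub>R\<^esub>"
proof -
  have x: "x \<in> carrier R"
    using assms component_closed by blast
  \<comment> \<open>Both \<open>?u g\<close> and \<open>?u h\<close> sum to \<open>x\<close> over
    \<open>{g, h}\<close>, once with \<open>x\<close> placed in degree \<open>g\<close> and once in
    degree \<open>h\<close>.\<close>
  let ?u = "\<lambda>l k. if k = l then x else \<zero>\<^bsub>R\<^esub>"
  have "?u g g = ?u h g"
  proof (rule decomposition_unique[of "{g, h}" "?u g" "?u h" g])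
    show "finsum R (?u g) {g, h} = finsum R (?u h) {g, h}"
      using x assms(3) by (simp add: R.finsum_insert)
  qed (use assms component_zero in auto)
  then show ?thesis
    using assms(3) by simp
qed

text \<open>If \<open>r\<close> is nonzero and \<open>a\<close> has degree \<open>h\<close>, then
  \<open>r = r a r\<close> lies in degree \<open>g\<close> and in degree \<open>g h g\<close>.
  Distinct components meet only in zero, so the two degrees agree and \<open>h\<close> is the
  inverse of \<open>g\<close>. For \<open>r = 0\<close> the choice \<open>a = 0\<close>
  works.\<close>

lemma graded_regular_inner_inverse:
  assumes g: "g \<in> carrier G" and r: "r \<in> A g" "r \<in> graded_regular G R A"
  obtains a where "a \<in> A (inv\<^bsub>G\<^esub> g)" "r = r \<otimes>\<^bsub>R\<^esub> a \<otimes>\<^bsub>R\<^esub> r"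
proof (cases "r = \<zero>\<^bsub>R\<^esub>")
  case True
  then show thesis
    using g that[of "\<zero>\<^bsub>R\<^esub>"] by (simp add: component_zero)
next
  case False
  obtain h a where h: "h \<in> carrier G" and a: "a \<in> A h" and eq: "r = r \<otimes>\<^bsub>R\<^esub> a \<otimes>\<^bsub>R\<^esub> r"
    using r(2) by (auto simp: graded_regular_def homogeneous_def)
  have "r \<in> A (g \<otimes>\<^bsub>G\<^esub> h \<otimes>\<^bsub>G\<^esub> g)"
    by (subst eq) (use g h r a in \<open>auto intro!: component_mult\<close>)
  then have "g \<otimes>\<^bsub>G\<^esub> h \<otimes>\<^bsub>G\<^esub> g = g"
    using component_inter[OF g _ _ r(1)] False g h by (metis G.m_closed)
  then have "g \<otimes>\<^bsub>G\<^esub> h = \<one>\<^bsub>G\<^esub>"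
    using g h by (simp add: G.r_cancel_one)
  then have "h = inv\<^bsub>G\<^esub> g"
    using g h by (metis G.inv_equality G.inv_comm)
  then show thesis
    using that a eq by blast
qed

end

text \<open>If one summand has degree \<open>g\<close>, so has the other, by subtraction. If neither
  has, then \<open>x\<close> has no part of degree \<open>g\<close> and must be zero, in which case
  both summands can be taken zero.\<close>

lemma (in graded_NR_clean) NR_clean_component:
  assumes g: "g \<in> carrier G" and x: "x \<in> A g"
  obtains r m where "r \<in> A g" "r \<in> graded_regular G R A" "m \<in> A g" "m \<in> nilpotents R"
    "x = r \<oplus>\<^bsub>R\<^esub> m"
proof (cases "x = \<zero>\<^bsub>R\<^esub>")
  case True
  have "\<zero>\<^bsub>R\<^esub> \<in> graded_regular G R A"
    using component_zero[OF g] g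
    unfolding graded_regular_def homogeneous_def by (auto intro!: bexI[of _ g] bexI[of _ "\<zero>\<^bsub>R\<^esub>"])
  moreover have "\<zero>\<^bsub>R\<^esub> \<in> nilpotents R"
    unfolding nilpotents_def by (auto intro!: exI[of _ 1])
  ultimately show thesis
    using that[of "\<zero>\<^bsub>R\<^esub>" "\<zero>\<^bsub>R\<^esub>"] True g by (simp add: component_zero)
next
  case False
  have "x \<in> homogeneous G A"
    using g x by (auto simp: homogeneous_def)
  then obtain r m where r: "r \<in> graded_regular G R A"
    and m: "m \<in> nilpotents R" "m \<in> homogeneous G A" and eq: "x = r \<oplus>\<^bsub>R\<^esub> m"
    using NR_clean by blast
  obtain a where a: "a \<in> carrier G" "r \<in> A a"
    using r by (auto simp: graded_regular_def homogeneous_def)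
  obtain b where b: "b \<in> carrier G" "m \<in> A b"
    using m by (auto simp: homogeneous_def)
  have closed: "x \<in> carrier R" "r \<in> carrier R" "m \<in> carrier R"
    using component_closed g x a b by blast+
  consider "a = g" | "b = g" | "a \<noteq> g" "b \<noteq> g"
    by blast
  then show thesis
  proof cases
    case 1
    have "m = \<ominus>\<^bsub>R\<^esub> r \<oplus>\<^bsub>R\<^esub> x"
      using closed by (simp add: eq R.r_neg1)
    then have "m \<in> A g"
      using 1 a g x by (auto intro: component_add component_neg)
    then show thesis
      using that 1 a r m eq by blast
  next
    case 2
    have "r = x \<oplus>\<^bsub>R\<^esub> \<ominus>\<^bsub>R\<^esub> m"
      using closed by (simp add: eq R.a_assoc R.r_neg)
    then have "r \<in> A g"
      using 2 b g x by (metis component_add component_neg)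
    then show thesis
      using that 2 b r m eq by blast
  next
    case 3
    \<comment> \<open>If both summands had the same degree, \<open>x\<close> would lie in that
      component as well as in \<open>A g\<close>, and so be zero.\<close>
    have "a \<noteq> b"
      using component_inter[OF g a(1) _ x] component_add[OF a] 3 False b(2) eq by blast
    \<comment> \<open>Two decompositions of \<open>x\<close> over \<open>{g, a, b}\<close>; in
      degree \<open>g\<close> the first has \<open>x\<close> and the second has zero.\<close>
    let ?f = "\<lambda>k. if k = g then x else \<zero>\<^bsub>R\<^esub>"
    let ?h = "\<lambda>k. if k = a then r else if k = b then m else \<zero>\<^bsub>R\<^esub>"
    have "?f g = ?h g"
    proof (rule decomposition_unique[of "{g, a, b}" ?f ?h g])
      show "finsum R ?f {g, a, b} = finsum R ?h {g, a, b}"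
        using closed 3 \<open>a \<noteq> b\<close> eq by (simp add: R.finsum_insert)
    qed (use g x a b component_zero in auto)
    then show thesis
      using 3 False by simp
  qed
qed

section \<open>Triangular matrices over graded rings\<close>

lemma triangular_grading_memD:
  assumes "M \<in> triangular_grading G R A n \<sigma> g"
  shows "M \<in> carrier (triangular_ring R n)"
    and "i \<in> {1..n} \<Longrightarrow> j \<in> {1..n} \<Longrightarrow> M (i, j) \<in> A (\<sigma> i \<otimes>\<^bsub>G\<^esub> g \<otimes>\<^bsub>G\<^esub> inv\<^bsub>G\<^esub> (\<sigma> j))"
  using assms by (auto simp: triangular_grading_def matrix_grading_def)

section \<open>The grading of the triangular matrix ring\<close>

context graded_ring
begin

lemma triangular_grading_memI:
  assumes \<sigma>: "\<sigma> \<in> {1..n} \<rightarrow> carrier G" and g: "g \<in> carrier G"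
    and M: "M \<in> carrier (triangular_ring R n)"
    and entry: "\<And>i j. i \<in> {1..n} \<Longrightarrow> j \<in> {1..n} \<Longrightarrow> i \<le> j \<Longrightarrow>
      M (i, j) \<in> A (\<sigma> i \<otimes>\<^bsub>G\<^esub> g \<otimes>\<^bsub>G\<^esub> inv\<^bsub>G\<^esub> (\<sigma> j))"
  shows "M \<in> triangular_grading G R A n \<sigma> g"
proof -
  have "M (i, j) \<in> A (\<sigma> i \<otimes>\<^bsub>G\<^esub> g \<otimes>\<^bsub>G\<^esub> inv\<^bsub>G\<^esub> (\<sigma> j))" if ij: "i \<in> {1..n}" "j \<in> {1..n}" for i j
  proof (cases "i \<le> j")
    case False
    have "\<sigma> i \<otimes>\<^bsub>G\<^esub> g \<otimes>\<^bsub>G\<^esub> inv\<^bsub>G\<^esub> (\<sigma> j) \<in> carrier G"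
      using \<sigma> g ij by (simp add: Pi_iff)
    then show ?thesis
      using False ij triangular_entry_zero[OF M] component_zero by simp
  qed (use entry ij in blast)
  then show ?thesis
    using M by (simp add: triangular_grading_def matrix_grading_def triangular_ring_def)
qed

lemma triangular_component_subgroup:
  assumes \<sigma>: "\<sigma> \<in> {1..n} \<rightarrow> carrier G" and g: "g \<in> carrier G"
  shows "additive_subgroup (triangular_grading G R A n \<sigma> g) (triangular_ring R n)"
proof -
  interpret T: ring "triangular_ring R n" by (rule R.ring_triangular_ring)
  note D = triangular_grading_memD[of _ G R A n \<sigma> g]
  have deg: "\<sigma> i \<otimes>\<^bsub>G\<^esub> g \<otimes>\<^bsub>G\<^esub> inv\<^bsub>G\<^esub> (\<sigma> j) \<in> carrier G" if "i \<in> {1..n}" "j \<in> {1..n}" for i j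
    using \<sigma> g that by (simp add: Pi_iff)
  show ?thesis
  proof (rule additive_subgroupI, rule T.add.subgroupI)
    have "\<zero>\<^bsub>triangular_ring R n\<^esub> \<in> triangular_grading G R A n \<sigma> g"
      by (rule triangular_grading_memI[OF \<sigma> g T.zero_closed])
         (simp only: triangular_ring_simps matrix_zero_entry component_zero deg)
    then show "triangular_grading G R A n \<sigma> g \<noteq> {}"
      by blast
  next
    fix M assume M: "M \<in> triangular_grading G R A n \<sigma> g"
    show "\<ominus>\<^bsub>triangular_ring R n\<^esub> M \<in> triangular_grading G R A n \<sigma> g"
      by (rule triangular_grading_memI[OF \<sigma> g T.a_inv_closed[OF D(1)[OF M]]])
         (simp only: R.triangular_neg_entry[OF D(1)[OF M]] component_neg deg D(2)[OF M])
  next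
    fix M N
    assume M: "M \<in> triangular_grading G R A n \<sigma> g" and N: "N \<in> triangular_grading G R A n \<sigma> g"
    show "M \<oplus>\<^bsub>triangular_ring R n\<^esub> N \<in> triangular_grading G R A n \<sigma> g"
      by (rule triangular_grading_memI[OF \<sigma> g T.a_closed[OF D(1)[OF M] D(1)[OF N]]])
         (simp only: triangular_ring_simps matrix_add_entry component_add deg D(2)[OF M] D(2)[OF N])
  qed (use D(1) in blast)
qed

text \<open>The inner factors \<open>\<sigma> k\<close> and their inverses cancel, so every summand
  of the \<open>(i, j)\<close> entry has the same degree, whatever \<open>k\<close> is.\<close>

lemma triangular_component_mult:
  assumes \<sigma>: "\<sigma> \<in> {1..n} \<rightarrow> carrier G" and gh: "g \<in> carrier G" "h \<in> carrier G"
    and M: "M \<in> triangular_grading G R A n \<sigma> g" and N: "N \<in> triangular_grading G R A n \<sigma> h"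
  shows "M \<otimes>\<^bsub>triangular_ring R n\<^esub> N \<in> triangular_grading G R A n \<sigma> (g \<otimes>\<^bsub>G\<^esub> h)"
proof -
  interpret T: ring "triangular_ring R n" by (rule R.ring_triangular_ring)
  show ?thesis
  proof (rule triangular_grading_memI[OF \<sigma>])
    fix i j assume ij: "i \<in> {1..n}" "j \<in> {1..n}"
    let ?d = "\<sigma> i \<otimes>\<^bsub>G\<^esub> (g \<otimes>\<^bsub>G\<^esub> h) \<otimes>\<^bsub>G\<^esub> inv\<^bsub>G\<^esub> (\<sigma> j)"
    have d: "?d \<in> carrier G"
      using \<sigma> gh ij by (simp add: Pi_iff)
    have "M (i, k) \<otimes>\<^bsub>R\<^esub> N (k, j) \<in> A ?d" if k: "k \<in> {1..n}" for k
    proof -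
      have \<sigma>': "\<sigma> i \<in> carrier G" "\<sigma> j \<in> carrier G" "\<sigma> k \<in> carrier G"
        using \<sigma> ij k by auto
      have "(\<sigma> i \<otimes>\<^bsub>G\<^esub> g \<otimes>\<^bsub>G\<^esub> inv\<^bsub>G\<^esub> (\<sigma> k)) \<otimes>\<^bsub>G\<^esub> (\<sigma> k \<otimes>\<^bsub>G\<^esub> h \<otimes>\<^bsub>G\<^esub> inv\<^bsub>G\<^esub> (\<sigma> j)) = ?d"
        using \<sigma>' gh by (simp add: G.m_assoc G.inv_solve_left')
      then show ?thesis
        using component_mult[OF _ _ triangular_grading_memD(2)[OF M ij(1) k]
            triangular_grading_memD(2)[OF N k ij(2)]] \<sigma>' gh
        by simp
    qed
    then show "(M \<otimes>\<^bsub>triangular_ring R n\<^esub> N) (i, j) \<in> A ?d"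
      unfolding triangular_ring_simps matrix_mult_entry[OF ij]
      by (rule R.additive_subgroup_finsum_closed[OF component_subgroup[OF d]])
  qed (use gh M N in \<open>auto intro: triangular_grading_memD(1)\<close>)
qed

text \<open>At each position the passage from matrix degree to entry degree is a bijection of
  \<open>G\<close>. Existence follows by decomposing the entries in \<open>R\<close> and collecting
  the pieces that belong to one matrix degree; uniqueness follows entry by entry.\<close>

lemma triangular_direct_sum:
  assumes \<sigma>: "\<sigma> \<in> {1..n} \<rightarrow> carrier G" and M: "M \<in> carrier (triangular_ring R n)"
  shows "\<exists>!f. f \<in> (\<Pi>\<^sub>E g\<in>carrier G. triangular_grading G R A n \<sigma> g) \<and>
    finite {g \<in> carrier G. f g \<noteq> \<zero>\<^bsub>triangular_ring R n\<^esub>} \<and>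
    M = (\<Oplus>\<^bsub>triangular_ring R n\<^esub>g\<in>{g \<in> carrier G. f g \<noteq> \<zero>\<^bsub>triangular_ring R n\<^esub>}. f g)"
    (is "\<exists>!f. ?P f")
proof -
  let ?T = "triangular_ring R n"
  interpret T: ring ?T by (rule R.ring_triangular_ring)
  define d where "d i j g = \<sigma> i \<otimes>\<^bsub>G\<^esub> g \<otimes>\<^bsub>G\<^esub> inv\<^bsub>G\<^esub> (\<sigma> j)" for i j g
  have d_closed: "d i j g \<in> carrier G" if "i \<in> {1..n}" "j \<in> {1..n}" "g \<in> carrier G" for i j g
    using \<sigma> that by (simp add: Pi_iff d_def)
  have d_inj: "inj_on (d i j) F" if "i \<in> {1..n}" "j \<in> {1..n}" "F \<subseteq> carrier G" for i j F
    using \<sigma> that by (intro inj_onI) (simp add: Pi_iff d_def subset_iff)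
  have d_surj: "\<exists>g\<in>carrier G. d i j g = h" if "i \<in> {1..n}" "j \<in> {1..n}" "h \<in> carrier G" for i j h
  proof
    have "\<sigma> i \<otimes>\<^bsub>G\<^esub> (inv\<^bsub>G\<^esub> (\<sigma> i) \<otimes>\<^bsub>G\<^esub> h) = h"
      using \<sigma> that by (simp add: Pi_iff G.m_assoc[symmetric])
    then show "d i j (inv\<^bsub>G\<^esub> (\<sigma> i) \<otimes>\<^bsub>G\<^esub> h \<otimes>\<^bsub>G\<^esub> \<sigma> j) = h"
      using \<sigma> that by (simp add: Pi_iff d_def G.m_assoc)
    show "inv\<^bsub>G\<^esub> (\<sigma> i) \<otimes>\<^bsub>G\<^esub> h \<otimes>\<^bsub>G\<^esub> \<sigma> j \<in> carrier G"
      using \<sigma> that by (simp add: Pi_iff)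
  qed
  have zero: "\<zero>\<^bsub>?T\<^esub> (i, j) = \<zero>\<^bsub>R\<^esub>" if "i \<in> {1..n}" "j \<in> {1..n}" for i j
    using that by (simp only: triangular_ring_simps matrix_zero_entry)
  \<comment> \<open>\<open>Q i j u\<close> says that \<open>u\<close> is a homogeneous decomposition
    of \<open>M (i, j)\<close>; stated as a predicate, it allows one choice \<open>c\<close> for all
    positions.\<close>
  define Q where "Q i j u \<longleftrightarrow> (\<forall>g\<in>carrier G. u g \<in> A g) \<and> finite {g \<in> carrier G. u g \<noteq> \<zero>\<^bsub>R\<^esub>} \<and>
    (\<forall>F. finite F \<longrightarrow> F \<subseteq> carrier G \<longrightarrow> {g \<in> carrier G. u g \<noteq> \<zero>\<^bsub>R\<^esub>} \<subseteq> F \<longrightarrow> finsum R u F = M (i, j))"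
    for i j u
  define c where "c i j = (SOME u. Q i j u)" for i j
  have Q: "Q i j (c i j)" if ij: "i \<in> {1..n}" "j \<in> {1..n}" for i j
    unfolding c_def
  proof (rule someI_ex[of "Q i j"])
    obtain u where "\<And>g. g \<in> carrier G \<Longrightarrow> u g \<in> A g" "finite {g \<in> carrier G. u g \<noteq> \<zero>\<^bsub>R\<^esub>}"
      "\<And>F. finite F \<Longrightarrow> F \<subseteq> carrier G \<Longrightarrow> {g \<in> carrier G. u g \<noteq> \<zero>\<^bsub>R\<^esub>} \<subseteq> F \<Longrightarrow> finsum R u F = M (i, j)"
      by (rule obtain_decomposition[OF triangular_entry_closed[OF M ij]]) (rule that, simp_all)
    then have "Q i j u"
      by (simp add: Q_def)
    then show "\<exists>u. Q i j u" by blast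
  qed
  have c: "c i j g \<in> A g" if "i \<in> {1..n}" "j \<in> {1..n}" "g \<in> carrier G" for i j g
    using Q[OF that(1,2)] that(3) by (simp add: Q_def)
  have c_fin: "finite {g \<in> carrier G. c i j g \<noteq> \<zero>\<^bsub>R\<^esub>}" if "i \<in> {1..n}" "j \<in> {1..n}" for i j
    using Q[OF that] by (simp add: Q_def)
  have c_sum: "finsum R (c i j) F = M (i, j)"
    if "i \<in> {1..n}" "j \<in> {1..n}" "finite F" "F \<subseteq> carrier G" "{g \<in> carrier G. c i j g \<noteq> \<zero>\<^bsub>R\<^esub>} \<subseteq> F"
    for i j F
    using Q[OF that(1,2)] that(3-) by (simp add: Q_def)
  \<comment> \<open>The part of \<open>M\<close> in degree \<open>g\<close>: on and above the
    diagonal, position \<open>(i, j)\<close> receives the component of \<open>M (i, j)\<close> in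
    degree \<open>d i j g\<close>.\<close>
  define f where "f = (\<lambda>g\<in>carrier G. \<lambda>(i, j)\<in>{1..n} \<times> {1..n}. if i \<le> j then c i j (d i j g) else \<zero>\<^bsub>R\<^esub>)"
  define S where "S = {g \<in> carrier G. f g \<noteq> \<zero>\<^bsub>?T\<^esub>}"
  have f_entry: "f g (i, j) = c i j (d i j g)"
    if "g \<in> carrier G" "i \<in> {1..n}" "j \<in> {1..n}" "i \<le> j" for g i j
    using that by (simp add: f_def)
  have f_closed: "f g \<in> carrier ?T" if "g \<in> carrier G" for g
    using that component_closed[OF d_closed c[OF _ _ d_closed]] by (auto simp: f_def triangular_ring_simps)
  have f_mem: "f g \<in> triangular_grading G R A n \<sigma> g" if "g \<in> carrier G" for g
    using that c d_closed f_entry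
    by (intro triangular_grading_memI[OF \<sigma>] f_closed) (simp_all add: d_def)
  \<comment> \<open>A nonzero \<open>f g\<close> has a nonzero entry, so \<open>S\<close> lies in a
    finite union, over positions, of preimages of finite supports under the injective maps
    \<open>d i j\<close>.\<close>
  have S_fin: "finite S"
  proof (rule finite_subset)
    let ?S = "\<lambda>(i, j). {g \<in> carrier G. c i j (d i j g) \<noteq> \<zero>\<^bsub>R\<^esub>}"
    show "S \<subseteq> (\<Union>p\<in>{1..n} \<times> {1..n}. ?S p)"
    proof
      fix g assume g: "g \<in> S"
      then have "\<exists>i\<in>{1..n}. \<exists>j\<in>{1..n}. i \<le> j \<and> f g (i, j) \<noteq> \<zero>\<^bsub>R\<^esub>"
        using triangular_eqI[OF f_closed T.zero_closed] zero unfolding S_def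
        by (metis (mono_tags, lifting) mem_Collect_eq)
      then show "g \<in> (\<Union>p\<in>{1..n} \<times> {1..n}. ?S p)"
        using g f_entry by (fastforce simp: S_def)
    qed
    have "finite (?S (i, j))" if ij: "i \<in> {1..n}" "j \<in> {1..n}" for i j
    proof (rule finite_imageD)
      show "finite (d i j ` ?S (i, j))"
        using d_closed[OF ij] by (intro finite_subset[OF _ c_fin[OF ij]]) auto
      show "inj_on (d i j) (?S (i, j))"
        using ij by (intro d_inj) auto
    qed
    then show "finite (\<Union>p\<in>{1..n} \<times> {1..n}. ?S p)"
      by blast
  qed
  have M_sum: "M = finsum ?T f S"
  proof (rule triangular_eqI[OF M])
    show "finsum ?T f S \<in> carrier ?T"
      using f_closed by (intro T.finsum_closed) (auto simp: S_def)
    fix i j assume ij: "i \<in> {1..n}" "j \<in> {1..n}" "i \<le> j"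
    have S_sub: "S \<subseteq> carrier G"
      by (auto simp: S_def)
    \<comment> \<open>Surjectivity of \<open>d i j\<close> guarantees that no piece of
      \<open>M (i, j)\<close> is lost when only the degrees coming from \<open>S\<close> are
      summed.\<close>
    have "{g \<in> carrier G. c i j g \<noteq> \<zero>\<^bsub>R\<^esub>} \<subseteq> d i j ` S"
    proof
      fix h assume h: "h \<in> {g \<in> carrier G. c i j g \<noteq> \<zero>\<^bsub>R\<^esub>}"
      then obtain g where g: "g \<in> carrier G" "d i j g = h"
        using d_surj ij by blast
      then have "f g (i, j) \<noteq> \<zero>\<^bsub>?T\<^esub> (i, j)"
        using h f_entry zero ij by simp
      then show "h \<in> d i j ` S"
        using g by (auto simp: S_def)
    qed
    then have "M (i, j) = finsum R (c i j) (d i j ` S)"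
      using ij S_fin S_sub d_closed by (intro c_sum[symmetric]) auto
    also have "\<dots> = (\<Oplus>\<^bsub>R\<^esub>g\<in>S. c i j (d i j g))"
      using ij S_sub c d_closed component_closed d_inj by (intro R.finsum_reindex) blast+
    also have "\<dots> = (\<Oplus>\<^bsub>R\<^esub>g\<in>S. f g (i, j))"
      using ij S_sub f_entry component_closed[OF d_closed c[OF _ _ d_closed]]
      by (intro R.finsum_cong') (auto simp: subset_iff)
    also have "\<dots> = (finsum ?T f S) (i, j)"
      using ij S_sub f_closed by (intro R.triangular_finsum_entry[symmetric]) auto
    finally show "M (i, j) = (finsum ?T f S) (i, j)" .
  qed
  have "f \<in> extensional (carrier G)"
    by (simp add: f_def)
  then have "?P f"
    using f_mem S_fin M_sum unfolding S_def by (simp add: PiE_iff)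
  moreover have "u = v" if u: "?P u" and v: "?P v" for u v
  proof -
    let ?supp = "\<lambda>u. {g \<in> carrier G. u g \<noteq> \<zero>\<^bsub>?T\<^esub>}"
    \<comment> \<open>Over the union of the supports both families can be summed and compared;
      outside it both are zero.\<close>
    define F where "F = ?supp u \<union> ?supp v"
    have F: "finite F" "F \<subseteq> carrier G"
      using u v by (auto simp: F_def)
    have mem: "w g \<in> triangular_grading G R A n \<sigma> g" if "?P w" "g \<in> carrier G" for w g
      using that by (blast dest: PiE_mem)
    have closed: "w \<in> F \<rightarrow> carrier ?T" if w: "?P w" for w
      using triangular_grading_memD(1)[OF mem[OF w]] F(2) by (simp add: Pi_iff subset_iff)
    have sum: "finsum ?T w F = M" if w: "?P w" and supp: "?supp w \<subseteq> F" for w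
    proof -
      have "finsum ?T w F = finsum ?T w (?supp w)"
        using F(1) supp
      proof (rule T.add.finprod_mono_neutral_cong_right)
        show "w g = \<zero>\<^bsub>?T\<^esub>" if "g \<in> F - ?supp w" for g
          using F(2) that by auto
      qed (simp_all add: closed[OF w])
      then show ?thesis
        using w by simp
    qed
    have "u g (i, j) = v g (i, j)" if ij: "i \<in> {1..n}" "j \<in> {1..n}" and g: "g \<in> F" for g i j
    proof (rule decomposition_unique_reindex[of F "d i j" "\<lambda>g. u g (i, j)" "\<lambda>g. v g (i, j)"])
      have entry: "(\<Oplus>\<^bsub>R\<^esub>g\<in>F. w g (i, j)) = M (i, j)" if w: "?P w" "?supp w \<subseteq> F" for w
        using R.triangular_finsum_entry[OF closed[OF w(1)] ij] sum[OF w] by simp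
      show "(\<Oplus>\<^bsub>R\<^esub>g\<in>F. u g (i, j)) = (\<Oplus>\<^bsub>R\<^esub>g\<in>F. v g (i, j))"
        using entry[OF u] entry[OF v] by (simp add: F_def)
      show "u g (i, j) \<in> A (d i j g)" if "g \<in> F" for g
        unfolding d_def using that F(2) by (intro triangular_grading_memD(2)[OF mem[OF u]] ij) auto
      show "v g (i, j) \<in> A (d i j g)" if "g \<in> F" for g
        unfolding d_def using that F(2) by (intro triangular_grading_memD(2)[OF mem[OF v]] ij) auto
    qed (use F ij g d_inj d_closed in auto)
    then have eq: "u g = v g" if "g \<in> F" for g
      using that closed[OF u] closed[OF v]
      by (intro triangular_eqI[of _ R n]) (auto simp: Pi_iff)
    show "u = v"
    proof (rule PiE_ext)
      show "u \<in> (\<Pi>\<^sub>E g\<in>carrier G. triangular_grading G R A n \<sigma> g)"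
        "v \<in> (\<Pi>\<^sub>E g\<in>carrier G. triangular_grading G R A n \<sigma> g)"
        using u v by blast+
      show "u g = v g" if "g \<in> carrier G" for g
        using eq[of g] that by (cases "g \<in> F") (auto simp: F_def)
    qed
  qed
  ultimately show ?thesis
    by (intro ex_ex1I exI[of ?P f])
qed

lemma graded_ring_triangular:
  assumes "\<sigma> \<in> {1..n} \<rightarrow> carrier G"
  shows "graded_ring G (triangular_ring R n) (triangular_grading G R A n \<sigma>)"
  using assms
  by (intro graded_ring.intro graded_ring_axioms.intro G.group_axioms R.ring_triangular_ring
      triangular_component_subgroup triangular_component_mult triangular_direct_sum)

end

section \<open>Transfer of graded NR-cleanness in both directions\<close>

lemma (in graded_NR_clean) graded_NR_clean_triangular:
  assumes comm: "comm_group G" and \<sigma>: "\<sigma> \<in> {1..n} \<rightarrow> carrier G"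
  shows "graded_NR_clean G (triangular_ring R n) (triangular_grading G R A n \<sigma>)"
proof -
  let ?T = "triangular_ring R n" and ?A = "triangular_grading G R A n \<sigma>"
  interpret T: graded_ring G ?T ?A
    using \<sigma> by (rule graded_ring_triangular)
  interpret C: comm_group G by fact
  \<comment> \<open>This is where commutativity of \<open>G\<close> enters: conjugation by
    \<open>\<sigma> i\<close> fixes the degree.\<close>
  have diag_deg: "\<sigma> i \<otimes>\<^bsub>G\<^esub> g \<otimes>\<^bsub>G\<^esub> inv\<^bsub>G\<^esub> (\<sigma> i) = g" if "i \<in> {1..n}" "g \<in> carrier G" for i g
    using \<sigma> that by (simp add: Pi_iff C.m_comm[of "\<sigma> i" g] G.m_assoc)
  define diag where "diag a = (\<lambda>(i, j)\<in>{1..n} \<times> {1..n}. if i = j then a i else \<zero>\<^bsub>R\<^esub>)" for a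
  have diag_entry: "diag a (i, j) = (if i = j then a i else \<zero>\<^bsub>R\<^esub>)"
    if "i \<in> {1..n}" "j \<in> {1..n}" for a i j
    using that by (simp add: diag_def)
  have diag_mem: "diag a \<in> ?A g"
    if g: "g \<in> carrier G" and a: "\<And>i. i \<in> {1..n} \<Longrightarrow> a i \<in> A g" for a g
  proof (rule triangular_grading_memI[OF \<sigma> g])
    show "diag a \<in> carrier ?T"
      using a component_closed[OF g] by (auto simp: diag_def triangular_ring_simps)
    fix i j assume ij: "i \<in> {1..n}" "j \<in> {1..n}"
    then have "\<sigma> i \<otimes>\<^bsub>G\<^esub> g \<otimes>\<^bsub>G\<^esub> inv\<^bsub>G\<^esub> (\<sigma> j) \<in> carrier G"
      using \<sigma> g by (simp add: Pi_iff)
    then show "diag a (i, j) \<in> A (\<sigma> i \<otimes>\<^bsub>G\<^esub> g \<otimes>\<^bsub>G\<^esub> inv\<^bsub>G\<^esub> (\<sigma> j))"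
      using ij g a component_zero by (simp add: diag_entry diag_deg)
  qed
  have diag_mult: "diag a \<otimes>\<^bsub>?T\<^esub> diag b = diag (\<lambda>i. a i \<otimes>\<^bsub>R\<^esub> b i)"
    if a: "\<And>i. i \<in> {1..n} \<Longrightarrow> a i \<in> carrier R" and b: "\<And>i. i \<in> {1..n} \<Longrightarrow> b i \<in> carrier R" for a b
  proof (rule matrix_eqI)
    show "diag a \<otimes>\<^bsub>?T\<^esub> diag b \<in> carrier (matrix_ring R n)"
      unfolding triangular_ring_simps
      using a b by (intro R.matrix_mult_closed) (auto simp: diag_def matrix_ring_simps)
    show "diag (\<lambda>i. a i \<otimes>\<^bsub>R\<^esub> b i) \<in> carrier (matrix_ring R n)"
      using a b by (auto simp: diag_def matrix_ring_simps)
    fix i j assume ij: "i \<in> {1..n}" "j \<in> {1..n}"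
    have "(diag a \<otimes>\<^bsub>?T\<^esub> diag b) (i, j) = diag a (i, i) \<otimes>\<^bsub>R\<^esub> diag b (i, j)"
      unfolding triangular_ring_simps matrix_mult_entry[OF ij]
      using ij a b by (intro R.finsum_eq_single) (auto simp: diag_entry)
    then show "(diag a \<otimes>\<^bsub>?T\<^esub> diag b) (i, j) = diag (\<lambda>i. a i \<otimes>\<^bsub>R\<^esub> b i) (i, j)"
      using ij a b by (auto simp: diag_entry)
  qed
  show ?thesis
  proof (intro graded_NR_clean.intro graded_NR_clean_axioms.intro T.graded_ring_axioms)
    fix M assume "M \<in> homogeneous G ?A"
    then obtain g where g: "g \<in> carrier G" and M: "M \<in> ?A g"
      by (auto simp: homogeneous_def)
    have g': "inv\<^bsub>G\<^esub> g \<in> carrier G"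
      using g by simp
    have "\<exists>r m a. r \<in> A g \<and> m \<in> nilpotents R \<and> M (i, i) = r \<oplus>\<^bsub>R\<^esub> m \<and>
        a \<in> A (inv\<^bsub>G\<^esub> g) \<and> r = r \<otimes>\<^bsub>R\<^esub> a \<otimes>\<^bsub>R\<^esub> r" if i: "i \<in> {1..n}" for i
    proof -
      have "M (i, i) \<in> A g"
        using triangular_grading_memD(2)[OF M i i] i g by (simp add: diag_deg)
      then obtain r m where "r \<in> A g" "r \<in> graded_regular G R A" "m \<in> nilpotents R"
        "M (i, i) = r \<oplus>\<^bsub>R\<^esub> m"
        using NR_clean_component[OF g] by metis
      then show ?thesis
        using graded_regular_inner_inverse[OF g] by metis
    qed
    then obtain r m a where r: "\<And>i. i \<in> {1..n} \<Longrightarrow> r i \<in> A g"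
      and m: "\<And>i. i \<in> {1..n} \<Longrightarrow> m i \<in> nilpotents R"
      and sum: "\<And>i. i \<in> {1..n} \<Longrightarrow> M (i, i) = r i \<oplus>\<^bsub>R\<^esub> m i"
      and a: "\<And>i. i \<in> {1..n} \<Longrightarrow> a i \<in> A (inv\<^bsub>G\<^esub> g)"
      and rar: "\<And>i. i \<in> {1..n} \<Longrightarrow> r i = r i \<otimes>\<^bsub>R\<^esub> a i \<otimes>\<^bsub>R\<^esub> r i"
      by metis
    have closed: "r i \<in> carrier R" "a i \<in> carrier R" "m i \<in> carrier R" if "i \<in> {1..n}" for i
      using component_closed[OF g r[OF that]] component_closed[OF g' a[OF that]] m[OF that]
      by (auto simp: nilpotents_def)
    have D: "diag r \<in> ?A g"
      using g r by (rule diag_mem)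
    have D': "diag a \<in> ?A (inv\<^bsub>G\<^esub> g)"
      using g' a by (rule diag_mem)
    have "diag r = diag r \<otimes>\<^bsub>?T\<^esub> diag a \<otimes>\<^bsub>?T\<^esub> diag r"
    proof -
      have "diag r \<otimes>\<^bsub>?T\<^esub> diag a \<otimes>\<^bsub>?T\<^esub> diag r = diag (\<lambda>i. r i \<otimes>\<^bsub>R\<^esub> a i \<otimes>\<^bsub>R\<^esub> r i)"
        using closed diag_mult[of r a] diag_mult[of "\<lambda>i. r i \<otimes>\<^bsub>R\<^esub> a i" r] by simp
      also have "\<dots> = diag r"
        by (auto simp: diag_def fun_eq_iff restrict_def rar[symmetric])
      finally show ?thesis ..
    qed
    moreover have "diag r \<in> homogeneous G ?A" "diag a \<in> homogeneous G ?A"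
      unfolding homogeneous_def using D D' g g' by blast+
    ultimately have D_reg: "diag r \<in> graded_regular G ?T ?A"
      unfolding graded_regular_def by (intro CollectI conjI bexI[of _ "diag a"])
    \<comment> \<open>As a difference of matrices of degree \<open>g\<close>, \<open>N\<close> is
      homogeneous; its diagonal consists of the nilpotent parts \<open>m i\<close>, and its entries
      above the diagonal are those of \<open>M\<close>.\<close>
    define N where "N = \<ominus>\<^bsub>?T\<^esub> diag r \<oplus>\<^bsub>?T\<^esub> M"
    have N: "N \<in> ?A g"
      unfolding N_def using g D M by (intro T.component_add T.component_neg)
    have M_eq: "M = diag r \<oplus>\<^bsub>?T\<^esub> N"
      unfolding N_def using triangular_grading_memD(1)[OF D] triangular_grading_memD(1)[OF M]
      by (simp add: T.R.r_neg2)
    have "N (i, i) = m i" if i: "i \<in> {1..n}" for i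
    proof -
      have "N (i, i) = \<ominus>\<^bsub>R\<^esub> r i \<oplus>\<^bsub>R\<^esub> M (i, i)"
        unfolding N_def triangular_ring_simps matrix_add_entry[OF i i]
        using R.triangular_neg_entry[OF triangular_grading_memD(1)[OF D] i i] i
        by (simp add: diag_entry)
      then show ?thesis
        using closed[OF i] sum[OF i] by (simp add: R.r_neg1)
    qed
    then have "N \<in> nilpotents ?T"
      using m triangular_grading_memD(1)[OF N] by (intro R.triangular_nilpotentI) auto
    then show "\<exists>r\<in>graded_regular G ?T ?A. \<exists>m\<in>nilpotents ?T \<inter> homogeneous G ?A. M = r \<oplus>\<^bsub>?T\<^esub> m"
      using D_reg N g M_eq by (auto simp: homogeneous_def)
  qed
qed

text \<open>With all shifts trivial, every entry of a matrix of degree \<open>g\<close> again has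
  degree \<open>g\<close>. Taking the \<open>(1, 1)\<close> entry respects sums, products and powers
  of triangular matrices, and \<open>n \<ge> 1\<close> provides that position.\<close>

lemma (in graded_ring) graded_NR_clean_of_triangular:
  assumes n: "n \<ge> 1"
    and clean: "graded_NR_clean G (triangular_ring R n) (triangular_grading G R A n (\<lambda>_. \<one>\<^bsub>G\<^esub>))"
  shows "graded_NR_clean G R A"
proof (intro graded_NR_clean.intro graded_NR_clean_axioms.intro graded_ring_axioms)
  let ?T = "triangular_ring R n" and ?A = "triangular_grading G R A n (\<lambda>_. \<one>\<^bsub>G\<^esub>)"
  interpret T: graded_NR_clean G ?T ?A by (rule clean)
  have one: "1 \<in> {1..n}"
    using n by simp
  have corner: "M (1, 1) \<in> A g" if "g \<in> carrier G" "M \<in> ?A g" for M g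
    using triangular_grading_memD(2)[OF that(2) one one] that(1) by simp
  have homogeneous_corner: "M (1, 1) \<in> homogeneous G A" if "M \<in> homogeneous G ?A" for M
    using that corner by (auto simp: homogeneous_def)
  have homogeneous_closed: "M \<in> carrier ?T" if "M \<in> homogeneous G ?A" for M
    using that by (auto simp: homogeneous_def dest: triangular_grading_memD(1))
  fix x assume "x \<in> homogeneous G A"
  then obtain g where g: "g \<in> carrier G" and x: "x \<in> A g"
    by (auto simp: homogeneous_def)
  \<comment> \<open>A homogeneous lift of \<open>x\<close> through the corner projection.\<close>
  define E where "E = (\<lambda>(i, j)\<in>{1..n} \<times> {1..n}. if i = 1 \<and> j = 1 then x else \<zero>\<^bsub>R\<^esub>)"
  have "E \<in> ?A g"
    using g x component_closed[OF g x] component_zero[OF g]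
    by (intro triangular_grading_memI) (auto simp: E_def triangular_ring_simps)
  then have "E \<in> homogeneous G ?A"
    using g by (auto simp: homogeneous_def)
  then obtain P N where P: "P \<in> graded_regular G ?T ?A"
    and N: "N \<in> nilpotents ?T" "N \<in> homogeneous G ?A" and E: "E = P \<oplus>\<^bsub>?T\<^esub> N"
    using T.NR_clean by blast
  \<comment> \<open>The degrees of \<open>P\<close> and \<open>B\<close> may be arbitrary, since
    \<open>homogeneous_corner\<close> holds in every degree.\<close>
  obtain B where B: "P \<in> homogeneous G ?A" "B \<in> homogeneous G ?A" "P = P \<otimes>\<^bsub>?T\<^esub> B \<otimes>\<^bsub>?T\<^esub> P"
    using P by (auto simp: graded_regular_def)
  have closed: "P \<in> carrier ?T" "B \<in> carrier ?T" "N \<in> carrier ?T"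
    using B N homogeneous_closed by blast+
  have "P (1, 1) = (P \<otimes>\<^bsub>?T\<^esub> B \<otimes>\<^bsub>?T\<^esub> P) (1, 1)"
    using B(3) by simp
  also have "\<dots> = P (1, 1) \<otimes>\<^bsub>R\<^esub> B (1, 1) \<otimes>\<^bsub>R\<^esub> P (1, 1)"
    using closed one by (simp add: R.triangular_mult_diagonal)
  finally have "P (1, 1) \<in> graded_regular G R A"
    using B homogeneous_corner unfolding graded_regular_def by blast
  moreover have "N (1, 1) \<in> nilpotents R"
  proof -
    obtain k :: nat where k: "k > 0" "N [^]\<^bsub>?T\<^esub> k = \<zero>\<^bsub>?T\<^esub>"
      using N(1) by (auto simp: nilpotents_def)
    have "N (1, 1) [^]\<^bsub>R\<^esub> k = \<zero>\<^bsub>?T\<^esub> (1, 1)"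
      using R.triangular_pow_diagonal[OF closed(3) one, of k] k(2) by simp
    also have "\<dots> = \<zero>\<^bsub>R\<^esub>"
      using one by (simp only: triangular_ring_simps matrix_zero_entry)
    finally show ?thesis
      using k(1) triangular_entry_closed[OF closed(3) one one] by (auto simp: nilpotents_def)
  qed
  moreover have "x = P (1, 1) \<oplus>\<^bsub>R\<^esub> N (1, 1)"
  proof -
    have "x = E (1, 1)"
      using one by (simp add: E_def)
    also have "\<dots> = P (1, 1) \<oplus>\<^bsub>R\<^esub> N (1, 1)"
      unfolding E triangular_ring_simps matrix_add_entry[OF one one] ..
    finally show ?thesis .
  qed
  ultimately show "\<exists>r\<in>graded_regular G R A. \<exists>m\<in>nilpotents R \<inter> homogeneous G A. x = r \<oplus>\<^bsub>R\<^esub> m"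
    using homogeneous_corner[OF N(2)] by blast
qed

theorem theorem3p1:
  fixes G :: "('g, 'm) monoid_scheme" and R :: "('a, 'r) ring_scheme"
    and A :: "'g \<Rightarrow> 'a set" and n :: nat
  assumes "comm_group G" and "graded_ring G R A" and "n \<ge> 1"
  shows "graded_NR_clean G R A \<longleftrightarrow>
    (\<forall>\<sigma>\<in>{1..n} \<rightarrow> carrier G.
       graded_NR_clean G (triangular_ring R n) (triangular_grading G R A n \<sigma>))"
proof
  assume "graded_NR_clean G R A"
  then show "\<forall>\<sigma>\<in>{1..n} \<rightarrow> carrier G.
      graded_NR_clean G (triangular_ring R n) (triangular_grading G R A n \<sigma>)"
    using assms(1) by (blast intro: graded_NR_clean.graded_NR_clean_triangular)
next
  interpret graded_ring G R A by fact
  assume "\<forall>\<sigma>\<in>{1..n} \<rightarrow> carrier G.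
      graded_NR_clean G (triangular_ring R n) (triangular_grading G R A n \<sigma>)"
  then have "graded_NR_clean G (triangular_ring R n) (triangular_grading G R A n (\<lambda>_. \<one>\<^bsub>G\<^esub>))"
    by simp
  then show "graded_NR_clean G R A"
    using assms(3) by (rule graded_NR_clean_of_triangular[rotated])
qed

end
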